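(* Let $D$ be an integral domain with quotient field $K$ and let $E$ be a nonempty subset of $K$. If $\mathrm{Int}^{\mathrm R}(E,D)$ has finite character, then $D$ has finite character. Likewise, if $\mathrm{Int}^{\mathrm R}(E,D)$ has $t$-finite character, then $D$ has $t$-finite character.
   Context: $\mathrm{Int}^{\mathrm R}(E,D):=\{f\in K(X);\ f(E)\subseteq D\}$, where $f(E)\subseteq D$ means that for every $e\in E$ the rational function $f$ is defined at $e$ and $f(e)\in D$. For an integral domain $R$ with quotient field $F$ and a nonzero fractional ideal $I$ of $R$, $I^{-1}:=\{x\in F;\ xI\subseteq R\}$, $I_v:=(I^{-1})^{-1}$ and $I_t:=\bigcup J_v$, where $J$ ranges over the nonzero finitely generated ideals contained in $I$. A nonzero ideal $I$ of $R$ is a $t$-ideal if $I_t=I$; a $t$-maximal ideal is a maximal element among the proper $t$-ideals of $R$. $R$ has finite character (resp., $t$-finite character) if every nonzero element of $R$ belongs to only finitely many maximal ideals (resp., $t$-maximal ideals) of $R$. *)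

theory Defs
  imports
    "HOL-Algebra.Algebraic_Closure_Type"
    "HOL-Computational_Algebra.Polynomial"
    "HOL-Computational_Algebra.Fraction_Field"
begin

section \<open>Integral domains inside a field\<close>

text \<open>
  All integral domains here are subsets \<open>R\<close> of some field type: \<open>D\<close> of the type \<open>'k\<close>, and its
  ring of integer-valued rational functions of the type \<open>'k poly fract\<close>, which models \<open>K(X)\<close>.
\<close>

definition ring_on :: "'a::field set \<Rightarrow> 'a ring" where
  "ring_on R = ring_of_type_algebra\<lparr>carrier := R\<rparr>"

text \<open>
  The quotient field of \<open>R\<close>, realised inside the ambient field. It may be smaller than the ambient
  field: the ring of integer-valued rational functions can have a quotient field that is
  properly contained in \<open>K(X)\<close>.
\<close>

definition quot_field :: "'a::field set \<Rightarrow> 'a set" where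
  "quot_field R = {a / b | a b. a \<in> R \<and> b \<in> R \<and> b \<noteq> 0}"

definition finite_character :: "'a::field set \<Rightarrow> bool" where
  "finite_character R \<longleftrightarrow>
     (\<forall>x\<in>R. x \<noteq> 0 \<longrightarrow> finite {M. maximalideal M (ring_on R) \<and> x \<in> M})"


section \<open>The \<open>v\<close>- and \<open>t\<close>-operations\<close>

definition frac_inverse :: "'a::field set \<Rightarrow> 'a set \<Rightarrow> 'a set" where
  "frac_inverse R I = {x \<in> quot_field R. \<forall>y\<in>I. x * y \<in> R}"

definition v_closure :: "'a::field set \<Rightarrow> 'a set \<Rightarrow> 'a set" where
  "v_closure R I = frac_inverse R (frac_inverse R I)"

definition fin_gen_ideal :: "'a::field set \<Rightarrow> 'a set \<Rightarrow> bool" where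
  "fin_gen_ideal R J \<longleftrightarrow> (\<exists>S. finite S \<and> S \<subseteq> R \<and> J = genideal (ring_on R) S)"

text \<open>The definition of \<open>I\<^sub>t\<close> is meant for integral ideals \<open>I\<close> only.\<close>

definition t_closure :: "'a::field set \<Rightarrow> 'a set \<Rightarrow> 'a set" where
  "t_closure R I = \<Union>{v_closure R J | J. fin_gen_ideal R J \<and> J \<noteq> {0} \<and> J \<subseteq> I}"

definition t_ideal :: "'a::field set \<Rightarrow> 'a set \<Rightarrow> bool" where
  "t_ideal R I \<longleftrightarrow> ideal I (ring_on R) \<and> I \<noteq> {0} \<and> t_closure R I = I"

definition t_maximal_ideal :: "'a::field set \<Rightarrow> 'a set \<Rightarrow> bool" where
  "t_maximal_ideal R M \<longleftrightarrow>
     t_ideal R M \<and> M \<noteq> R \<and> (\<forall>I. t_ideal R I \<and> I \<noteq> R \<and> M \<subseteq> I \<longrightarrow> I = M)"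

definition t_finite_character :: "'a::field set \<Rightarrow> bool" where
  "t_finite_character R \<longleftrightarrow>
     (\<forall>x\<in>R. x \<noteq> 0 \<longrightarrow> finite {M. t_maximal_ideal R M \<and> x \<in> M})"


section \<open>Integer-valued rational functions\<close>

text \<open>
  A rational function is defined at \<open>e\<close> if some representation \<open>p / q\<close> of it has \<open>q(e) \<noteq> 0\<close>
  (so in particular \<open>q \<noteq> 0\<close>). Its value \<open>p(e) / q(e)\<close> does not depend on the choice.
\<close>

definition defined_at :: "'k::field poly fract \<Rightarrow> 'k \<Rightarrow> bool" where
  "defined_at f e \<longleftrightarrow> (\<exists>p q. f = Fract p q \<and> poly q e \<noteq> 0)"

definition ratfun_eval :: "'k::field poly fract \<Rightarrow> 'k \<Rightarrow> 'k" where
  "ratfun_eval f e =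
     (THE y. \<exists>p q. f = Fract p q \<and> poly q e \<noteq> 0 \<and> y = poly p e / poly q e)"

lemma ratfun_eval_Fract:
  assumes "poly q e \<noteq> 0"
  shows "ratfun_eval (Fract p q) e = poly p e / poly q e"
  unfolding ratfun_eval_def
proof (rule the_equality)
  show "\<exists>p' q'. Fract p q = Fract p' q' \<and> poly q' e \<noteq> 0 \<and>
          poly p e / poly q e = poly p' e / poly q' e"
    using assms by blast
next
  fix y
  assume "\<exists>p' q'. Fract p q = Fract p' q' \<and> poly q' e \<noteq> 0 \<and> y = poly p' e / poly q' e"
  then obtain p' q' where *: "Fract p q = Fract p' q'" "poly q' e \<noteq> 0"
    "y = poly p' e / poly q' e"
    by blast
  have "q \<noteq> 0" "q' \<noteq> 0"
    using assms *(2) by auto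
  then have "p * q' = p' * q"
    using *(1) by (simp add: eq_fract)
  then have "poly p e * poly q' e = poly p' e * poly q e"
    by (metis poly_mult)
  then show "y = poly p e / poly q e"
    using assms *(2) unfolding *(3) by (simp add: frac_eq_eq)
qed

definition IntR :: "'k::field set \<Rightarrow> 'k set \<Rightarrow> 'k poly fract set" where
  "IntR E D = {f. \<forall>e\<in>E. defined_at f e \<and> ratfun_eval f e \<in> D}"

lemma IntR_subdomain:
  assumes D: "subdomain D (ring_of_type_algebra :: 'k::field ring)"
  shows "subdomain (IntR E D) (ring_of_type_algebra :: 'k poly fract ring)"
proof -
  interpret K: field "ring_of_type_algebra :: 'k ring"
    by (rule field_from_type_algebra)
  interpret L: field "ring_of_type_algebra :: 'k poly fract ring"
    by (rule field_from_type_algebra)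
  interpret D: subdomain D "ring_of_type_algebra :: 'k ring"
    by (rule D)
  have minus_K: "\<ominus>\<^bsub>ring_of_type_algebra\<^esub> x = - x" for x :: 'k
    by (rule K.minus_equality) (simp_all add: ring_of_type_algebra_def)
  have minus_L: "\<ominus>\<^bsub>ring_of_type_algebra\<^esub> f = - f" for f :: "'k poly fract"
    by (rule L.minus_equality) (simp_all add: ring_of_type_algebra_def)
  have one: "1 \<in> D"
    using D.one_closed by (simp add: ring_of_type_algebra_def)
  have add: "x + y \<in> D" if "x \<in> D" "y \<in> D" for x y
    using subringE(7)[OF D.subring_axioms that] by (simp add: ring_of_type_algebra_def)
  have mult: "x * y \<in> D" if "x \<in> D" "y \<in> D" for x y
    using subringE(6)[OF D.subring_axioms that] by (simp add: ring_of_type_algebra_def)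
  have neg: "- x \<in> D" if "x \<in> D" for x
    using subringE(5)[OF D.subring_axioms that] by (simp add: minus_K)
  have memI: "f \<in> IntR E D"
    if "\<And>e. e \<in> E \<Longrightarrow> \<exists>p q. f = Fract p q \<and> poly q e \<noteq> 0 \<and> poly p e / poly q e \<in> D" for f
    using that ratfun_eval_Fract unfolding IntR_def defined_at_def by fastforce
  have memE: "\<exists>p q. f = Fract p q \<and> poly q e \<noteq> 0 \<and> poly p e / poly q e \<in> D"
    if "f \<in> IntR E D" "e \<in> E" for f e
    using that ratfun_eval_Fract unfolding IntR_def defined_at_def by fastforce
  have one': "1 \<in> IntR E D"
  proof (rule memI)
    fix e
    show "\<exists>p q. 1 = Fract p q \<and> poly q e \<noteq> 0 \<and> poly p e / poly q e \<in> D"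
      using one by (intro exI[of _ 1]) (simp add: One_fract_def)
  qed
  have neg': "- f \<in> IntR E D" if f: "f \<in> IntR E D" for f
  proof (rule memI)
    fix e assume "e \<in> E"
    then obtain p q where "f = Fract p q" "poly q e \<noteq> 0" "poly p e / poly q e \<in> D"
      using memE[OF f] by blast
    then show "\<exists>p q. - f = Fract p q \<and> poly q e \<noteq> 0 \<and> poly p e / poly q e \<in> D"
      using neg[of "poly p e / poly q e"] by (intro exI[of _ "- p"] exI[of _ q]) simp
  qed
  have ops: "f + g \<in> IntR E D \<and> f * g \<in> IntR E D"
    if f: "f \<in> IntR E D" and g: "g \<in> IntR E D" for f g
  proof -
    have "(\<exists>p q. f + g = Fract p q \<and> poly q e \<noteq> 0 \<and> poly p e / poly q e \<in> D) \<and>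
          (\<exists>p q. f * g = Fract p q \<and> poly q e \<noteq> 0 \<and> poly p e / poly q e \<in> D)"
      if e: "e \<in> E" for e
    proof -
      obtain p q where f': "f = Fract p q" "poly q e \<noteq> 0" "poly p e / poly q e \<in> D"
        using memE[OF f e] by blast
      obtain r s where g': "g = Fract r s" "poly s e \<noteq> 0" "poly r e / poly s e \<in> D"
        using memE[OF g e] by blast
      have nz: "q \<noteq> 0" "s \<noteq> 0"
        using f'(2) g'(2) by auto
      have "f + g = Fract (p * s + r * q) (q * s)"
        using f'(1) g'(1) nz by simp
      moreover have "poly (p * s + r * q) e / poly (q * s) e
                       = poly p e / poly q e + poly r e / poly s e"
        using f'(2) g'(2) by (simp add: add_frac_eq)
      moreover have "f * g = Fract (p * r) (q * s)"
        using f'(1) g'(1) by simp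
      moreover have "poly (p * r) e / poly (q * s) e
                       = (poly p e / poly q e) * (poly r e / poly s e)"
        by simp
      moreover have "poly (q * s) e \<noteq> 0"
        using f'(2) g'(2) by simp
      ultimately show ?thesis
        using add[OF f'(3) g'(3)] mult[OF f'(3) g'(3)] by metis
    qed
    then show ?thesis
      using memI by blast
  qed
  have "subring (IntR E D) (ring_of_type_algebra :: 'k poly fract ring)"
  proof (rule L.subringI)
    show "IntR E D \<subseteq> carrier ring_of_type_algebra"
      by (simp add: ring_of_type_algebra_def)
    show "\<one>\<^bsub>ring_of_type_algebra\<^esub> \<in> IntR E D"
      using one' by (simp add: ring_of_type_algebra_def)
    show "\<ominus>\<^bsub>ring_of_type_algebra\<^esub> f \<in> IntR E D" if "f \<in> IntR E D" for f
      using neg'[OF that] by (simp add: minus_L)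
    show "f \<otimes>\<^bsub>ring_of_type_algebra\<^esub> g \<in> IntR E D" "f \<oplus>\<^bsub>ring_of_type_algebra\<^esub> g \<in> IntR E D"
      if "f \<in> IntR E D" "g \<in> IntR E D" for f g
      using ops[OF that] by (simp_all add: ring_of_type_algebra_def)
  qed
  then show ?thesis
    by (rule L.subdomainI')
qed

end

theory Submission
  imports Defs
begin

text \<open>
  Write \<open>R = Int\<^sup>R(E,D)\<close> and regard \<open>D\<close> as the subring of constants of \<open>R\<close>. Both claims follow
  from one principle: if every (\<open>t\<close>-)maximal ideal \<open>M\<close> of \<open>D\<close> is the trace \<open>P \<inter> D\<close> of some
  (\<open>t\<close>-)maximal ideal \<open>P\<close> of \<open>R\<close>, then the (\<open>t\<close>-)maximal ideals of \<open>D\<close> that contain \<open>x\<close> are traces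
  of (\<open>t\<close>-)maximal ideals of \<open>R\<close> that contain the constant \<open>x\<close>, so there are finitely many of them
  as soon as \<open>R\<close> has (\<open>t\<close>-)finite character.

  For maximal ideals, pick \<open>e \<in> E\<close> and let \<open>P = {f \<in> R. f(e) \<in> M}\<close>, the preimage of \<open>M\<close> under the
  surjection \<open>R \<rightarrow> D\<close> that evaluates at \<open>e\<close> (\<open>maximal_ideal_lies_over\<close>).

  For \<open>t\<close>-maximal ideals, it is not clear that such a preimage is a \<open>t\<close>-ideal: if \<open>f \<in> R\<close> and
  \<open>y f(e) \<in> D\<close> for some \<open>y \<in> K\<close>, then \<open>y f\<close> need not belong to \<open>R\<close>. The substitute is the identity
  \<open>(S R)\<^sub>v \<inter> D = S\<^sub>v\<close> for a finite set \<open>S \<subseteq> D\<close> with a nonzero element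
  (\<open>const_mem_v_closure_iff\<close>). It holds because a rational function \<open>h\<close> with \<open>h S \<subseteq> R\<close> has no pole
  on \<open>E\<close> and satisfies \<open>h(e) S \<subseteq> D\<close> for every \<open>e \<in> E\<close>. As \<open>S\<^sub>v \<subseteq> M\<close> for finite \<open>S \<subseteq> M\<close> with
  a nonzero element, no such set has \<open>1\<close> in the \<open>v\<close>-closure of the ideal that it generates in \<open>R\<close>, so Zorn's
  lemma yields a \<open>t\<close>-maximal ideal \<open>P\<close> of \<open>R\<close> above \<open>M\<close>. By the same identity \<open>P \<inter> D\<close> is a proper
  \<open>t\<close>-ideal of \<open>D\<close>; it contains \<open>M\<close> and hence equals \<open>M\<close> (\<open>t_maximal_ideal_lies_over\<close>).
\<close>

section \<open>Subrings of a field and their ideals\<close>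

text \<open>
  A subring of a field in terms of the operations of the type. The ideals of \<open>ring_on R\<close> are
  characterised in the same terms in \<open>ideal_iff\<close>.
\<close>

locale field_subring =
  fixes R :: "'a::field set"
  assumes zero_mem: "0 \<in> R"
    and one_mem: "1 \<in> R"
    and add_mem: "\<And>x y. x \<in> R \<Longrightarrow> y \<in> R \<Longrightarrow> x + y \<in> R"
    and mult_mem: "\<And>x y. x \<in> R \<Longrightarrow> y \<in> R \<Longrightarrow> x * y \<in> R"
    and uminus_mem: "\<And>x. x \<in> R \<Longrightarrow> - x \<in> R"

lemma field_subring_of_subdomain:
  assumes "subdomain R (ring_of_type_algebra :: 'a::field ring)"
  shows "field_subring R"
proof -
  interpret K: field "ring_of_type_algebra :: 'a ring"
    by (rule field_from_type_algebra)
  interpret R: subdomain R "ring_of_type_algebra :: 'a ring"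
    by (rule assms)
  have minus_K: "\<ominus>\<^bsub>ring_of_type_algebra\<^esub> x = - x" for x :: 'a
    by (rule K.minus_equality) (simp_all add: ring_of_type_algebra_def)
  show ?thesis
  proof
    show "0 \<in> R"
      using subringE(2)[OF R.subring_axioms] by (simp add: ring_of_type_algebra_def)
    show "1 \<in> R"
      using R.one_closed by (simp add: ring_of_type_algebra_def)
    show "x + y \<in> R" if "x \<in> R" "y \<in> R" for x y
      using subringE(7)[OF R.subring_axioms that] by (simp add: ring_of_type_algebra_def)
    show "x * y \<in> R" if "x \<in> R" "y \<in> R" for x y
      using subringE(6)[OF R.subring_axioms that] by (simp add: ring_of_type_algebra_def)
    show "- x \<in> R" if "x \<in> R" for x
      using subringE(5)[OF R.subring_axioms that] by (simp add: minus_K)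
  qed
qed

lemma ring_on_simps [simp]:
  "carrier (ring_on R) = R"
  "x \<oplus>\<^bsub>ring_on R\<^esub> y = x + y"
  "x \<otimes>\<^bsub>ring_on R\<^esub> y = x * y"
  "\<zero>\<^bsub>ring_on R\<^esub> = 0"
  "\<one>\<^bsub>ring_on R\<^esub> = 1"
  by (simp_all add: ring_on_def ring_of_type_algebra_def)

context field_subring
begin

lemma cring_ring_on: "cring (ring_on R)"
proof (rule cringI)
  show "abelian_group (ring_on R)"
  proof (rule abelian_groupI)
    show "\<exists>y\<in>carrier (ring_on R). y \<oplus>\<^bsub>ring_on R\<^esub> x = \<zero>\<^bsub>ring_on R\<^esub>"
      if "x \<in> carrier (ring_on R)" for x
      using that uminus_mem by (intro bexI[of _ "- x"]) auto
  qed (auto simp: zero_mem add_mem)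
  show "comm_monoid (ring_on R)"
    by (rule comm_monoidI) (auto simp: one_mem mult_mem)
qed (simp add: distrib_right)

lemma ideal_iff:
  "ideal I (ring_on R) \<longleftrightarrow>
     I \<subseteq> R \<and> 0 \<in> I \<and> (\<forall>x\<in>I. \<forall>y\<in>I. x + y \<in> I) \<and> (\<forall>r\<in>R. \<forall>x\<in>I. r * x \<in> I)"
  (is "_ \<longleftrightarrow> ?rhs")
proof
  interpret cring "ring_on R"
    by (rule cring_ring_on)
  {
    assume "ideal I (ring_on R)"
    then interpret I: ideal I "ring_on R" .
    show ?rhs
      using I.a_subset I.zero_closed I.a_closed I.I_l_closed by simp
  next
    assume I: ?rhs
    have "subgroup I (add_monoid (ring_on R))"
    proof (rule add.subgroupI)
      show "\<ominus>\<^bsub>ring_on R\<^esub> x \<in> I" if "x \<in> I" for x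
      proof -
        have "- 1 * x \<in> I"
          using I that one_mem uminus_mem by blast
        moreover have "\<ominus>\<^bsub>ring_on R\<^esub> x = - x"
          using I that uminus_mem by (intro minus_equality) auto
        ultimately show ?thesis
          by simp
      qed
    qed (use I in auto)
    moreover have "x * r \<in> I" if "x \<in> I" "r \<in> R" for x r
      using I that by (metis mult.commute)
    ultimately show "ideal I (ring_on R)"
      using I by (intro idealI ring_axioms) simp_all
  }
qed

lemma idealD:
  assumes "ideal I (ring_on R)"
  shows "I \<subseteq> R" "0 \<in> I" "\<And>x y. x \<in> I \<Longrightarrow> y \<in> I \<Longrightarrow> x + y \<in> I"
    "\<And>r x. r \<in> R \<Longrightarrow> x \<in> I \<Longrightarrow> r * x \<in> I"
  using assms unfolding ideal_iff by auto

lemma ideal_eq_iff_one_mem: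
  assumes "ideal I (ring_on R)"
  shows "I = R \<longleftrightarrow> 1 \<in> I"
proof
  assume "1 \<in> I"
  then have "r \<in> I" if "r \<in> R" for r
    using idealD(4)[OF assms that, of 1] by simp
  then show "I = R"
    using idealD(1)[OF assms] by blast
qed (simp add: one_mem)

section \<open>The \<open>v\<close>-closure and \<open>t\<close>-ideals in terms of finite sets\<close>

lemma subset_quot_field: "R \<subseteq> quot_field R"
proof
  fix x assume "x \<in> R"
  then show "x \<in> quot_field R"
    unfolding quot_field_def using one_mem \<open>x \<in> R\<close> by (intro CollectI exI[of _ x] exI[of _ 1]) simp
qed

text \<open>
  The operations \<open>frac_inverse\<close> and \<open>v_closure\<close> make sense for arbitrary sets, and a subset of \<open>R\<close>
  and the ideal that it generates have the same inverse. So finitely generated ideals can be replaced by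
  finite sets throughout.
\<close>

lemma frac_inverse_genideal:
  assumes "S \<subseteq> R"
  shows "frac_inverse R (genideal (ring_on R) S) = frac_inverse R S"
proof
  interpret cring "ring_on R"
    by (rule cring_ring_on)
  have "S \<subseteq> genideal (ring_on R) S"
    using genideal_self assms by simp
  then show "frac_inverse R (genideal (ring_on R) S) \<subseteq> frac_inverse R S"
    unfolding frac_inverse_def by blast
  show "frac_inverse R S \<subseteq> frac_inverse R (genideal (ring_on R) S)"
  proof
    fix x assume x: "x \<in> frac_inverse R S"
    have "ideal {y \<in> R. x * y \<in> R} (ring_on R)"
      unfolding ideal_iff
      using zero_mem add_mem mult_mem by (auto simp: distrib_left mult.left_commute)
    moreover have "S \<subseteq> {y \<in> R. x * y \<in> R}"
      using x assms unfolding frac_inverse_def by blast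
    ultimately have "genideal (ring_on R) S \<subseteq> {y \<in> R. x * y \<in> R}"
      by (rule genideal_minimal)
    then show "x \<in> frac_inverse R (genideal (ring_on R) S)"
      using x unfolding frac_inverse_def by blast
  qed
qed

lemma genideal_eq_zero_iff:
  assumes "S \<subseteq> R"
  shows "genideal (ring_on R) S = {0} \<longleftrightarrow> S \<subseteq> {0}"
proof
  interpret cring "ring_on R"
    by (rule cring_ring_on)
  show "S \<subseteq> {0}" if "genideal (ring_on R) S = {0}"
    using genideal_self[of S] assms that by simp
  show "genideal (ring_on R) S = {0}" if S: "S \<subseteq> {0}"
  proof -
    have "ideal {0} (ring_on R)"
      using zero_mem by (simp add: ideal_iff)
    then have "genideal (ring_on R) S \<subseteq> {0}"
      using S by (rule genideal_minimal)
    moreover have "0 \<in> genideal (ring_on R) S"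
      using idealD(2)[OF genideal_ideal] assms by simp
    ultimately show ?thesis
      by blast
  qed
qed

lemma v_closure_ideal:
  assumes "S \<subseteq> R"
  shows "ideal (v_closure R S) (ring_on R)"
proof -
  have one: "1 \<in> frac_inverse R S"
    using assms one_mem subset_quot_field unfolding frac_inverse_def by auto
  have sub: "v_closure R S \<subseteq> R"
    using one unfolding v_closure_def by (force simp: frac_inverse_def[of R "frac_inverse R S"])
  have "x + y \<in> v_closure R S" if "x \<in> v_closure R S" "y \<in> v_closure R S" for x y
  proof -
    have "x + y \<in> quot_field R"
      using that sub add_mem subset_quot_field by blast
    then show ?thesis
      using that add_mem
      unfolding v_closure_def frac_inverse_def[of R "frac_inverse R S"]
      by (auto simp: distrib_right)
  qed
  moreover have "r * x \<in> v_closure R S" if "r \<in> R" "x \<in> v_closure R S" for r x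
  proof -
    have "r * x \<in> quot_field R"
      using that sub mult_mem subset_quot_field by blast
    then show ?thesis
      using that mult_mem
      unfolding v_closure_def frac_inverse_def[of R "frac_inverse R S"]
      by (auto simp: mult.assoc)
  qed
  moreover have "0 \<in> v_closure R S"
    using zero_mem subset_quot_field
    unfolding v_closure_def frac_inverse_def[of R "frac_inverse R S"] by auto
  ultimately show ?thesis
    using sub by (simp add: ideal_iff)
qed

lemma subset_v_closure: "S \<subseteq> R \<Longrightarrow> S \<subseteq> v_closure R S"
  using subset_quot_field unfolding v_closure_def frac_inverse_def
  by (auto simp: mult.commute)

lemma v_closure_mono: "S \<subseteq> T \<Longrightarrow> v_closure R S \<subseteq> v_closure R T"
  unfolding v_closure_def frac_inverse_def by blast

lemma v_closure_subset_v_closure: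
  assumes "S \<subseteq> v_closure R T"
  shows "v_closure R S \<subseteq> v_closure R T"
proof -
  have "x * y \<in> R" if "x \<in> frac_inverse R T" "y \<in> S" for x y
    using assms that unfolding v_closure_def frac_inverse_def[of R "frac_inverse R T"]
    by (auto simp: mult.commute[of x])
  then have "frac_inverse R T \<subseteq> frac_inverse R S"
    unfolding frac_inverse_def by blast
  then show ?thesis
    unfolding v_closure_def frac_inverse_def by blast
qed

lemma t_closure_eq:
  assumes "ideal I (ring_on R)"
  shows "t_closure R I = \<Union>{v_closure R S | S. finite S \<and> S \<subseteq> I \<and> \<not> S \<subseteq> {0}}"
proof -
  interpret cring "ring_on R"
    by (rule cring_ring_on)
  have eq: "v_closure R (genideal (ring_on R) S) = v_closure R S" if "S \<subseteq> R" for S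
    using that by (simp add: v_closure_def frac_inverse_genideal)
  have "{v_closure R J | J. fin_gen_ideal R J \<and> J \<noteq> {0} \<and> J \<subseteq> I}
          = {v_closure R S | S. finite S \<and> S \<subseteq> I \<and> \<not> S \<subseteq> {0}}" (is "?A = ?B")
  proof
    show "?A \<subseteq> ?B"
    proof
      fix V assume "V \<in> ?A"
      then obtain S where S: "finite S" "S \<subseteq> R" "V = v_closure R (genideal (ring_on R) S)"
        "genideal (ring_on R) S \<noteq> {0}" "genideal (ring_on R) S \<subseteq> I"
        unfolding fin_gen_ideal_def by blast
      have "S \<subseteq> I"
        using genideal_self[of S] S by auto
      moreover have "V = v_closure R S" "\<not> S \<subseteq> {0}"
        using S eq genideal_eq_zero_iff by auto
      ultimately show "V \<in> ?B"
        using S(1) by (intro CollectI exI[of _ S]) simp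
    qed
    show "?B \<subseteq> ?A"
    proof
      fix V assume "V \<in> ?B"
      then obtain S where S: "finite S" "S \<subseteq> I" "\<not> S \<subseteq> {0}" "V = v_closure R S"
        by blast
      have "S \<subseteq> R"
        using S idealD(1)[OF assms] by blast
      moreover have "genideal (ring_on R) S \<subseteq> I"
        using assms S(2) by (rule genideal_minimal)
      ultimately show "V \<in> ?A"
        using S eq genideal_eq_zero_iff unfolding fin_gen_ideal_def
        by (intro CollectI exI[of _ "genideal (ring_on R) S"]) auto
    qed
  qed
  then show ?thesis
    by (simp add: t_closure_def)
qed

lemma t_ideal_iff:
  "t_ideal R I \<longleftrightarrow> ideal I (ring_on R) \<and> I \<noteq> {0} \<and>
     (\<forall>S. finite S \<and> S \<subseteq> I \<and> \<not> S \<subseteq> {0} \<longrightarrow> v_closure R S \<subseteq> I)"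
proof -
  have "I \<subseteq> t_closure R I" if I: "ideal I (ring_on R)" "I \<noteq> {0}"
  proof
    fix x assume x: "x \<in> I"
    obtain a where a: "a \<in> I" "a \<noteq> 0"
      using I idealD(2) by blast
    then have "x \<in> v_closure R {a, x}"
      using subset_v_closure[of "{a, x}"] x idealD(1)[OF I(1)] by blast
    then show "x \<in> t_closure R I"
      unfolding t_closure_eq[OF I(1)] using a x by (intro UnionI[of "v_closure R {a, x}"]) auto
  qed
  moreover have "t_closure R I \<subseteq> I \<longleftrightarrow>
      (\<forall>S. finite S \<and> S \<subseteq> I \<and> \<not> S \<subseteq> {0} \<longrightarrow> v_closure R S \<subseteq> I)"
    if "ideal I (ring_on R)"
    unfolding t_closure_eq[OF that] Sup_le_iff by auto
  ultimately show ?thesis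
    unfolding t_ideal_def by (metis subset_antisym subset_refl)
qed

lemma t_ideal_v_closure_subset:
  "t_ideal R I \<Longrightarrow> finite S \<Longrightarrow> S \<subseteq> I \<Longrightarrow> \<not> S \<subseteq> {0} \<Longrightarrow> v_closure R S \<subseteq> I"
  by (simp add: t_ideal_iff)

section \<open>Existence of \<open>t\<close>-maximal ideals\<close>

text \<open>
  The set \<open>N\<close> is the \<open>t\<close>-closure of the ideal generated by \<open>A\<close>. It is a \<open>t\<close>-ideal because the
  \<open>v\<close>-closures that form it are directed, so that a finite subset of \<open>N\<close> lies in a single one.
\<close>

lemma t_ideal_generated:
  assumes A: "A \<subseteq> R" "\<not> A \<subseteq> {0}"
  defines "N \<equiv> \<Union>{v_closure R S | S. finite S \<and> S \<subseteq> A \<and> \<not> S \<subseteq> {0}}"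
  shows "t_ideal R N" "A \<subseteq> N"
proof -
  have N: "x \<in> N \<longleftrightarrow> (\<exists>S. finite S \<and> S \<subseteq> A \<and> \<not> S \<subseteq> {0} \<and> x \<in> v_closure R S)" for x
    unfolding N_def by blast
  obtain a where a: "a \<in> A" "a \<noteq> 0"
    using A by blast
  have directed: "\<exists>S. finite S \<and> S \<subseteq> A \<and> \<not> S \<subseteq> {0} \<and> F \<subseteq> v_closure R S"
    if "finite F" "F \<subseteq> N" for F
    using that
  proof (induction F)
    case empty
    then show ?case
      using a by (intro exI[of _ "{a}"]) simp
  next
    case (insert x F)
    then obtain S T where S: "finite S" "S \<subseteq> A" "\<not> S \<subseteq> {0}" "F \<subseteq> v_closure R S"
      and T: "finite T" "T \<subseteq> A" "x \<in> v_closure R T"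
      using N by auto
    have "insert x F \<subseteq> v_closure R (S \<union> T)"
      using S(4) T(3) v_closure_mono[of S "S \<union> T"] v_closure_mono[of T "S \<union> T"] by blast
    then show ?case
      using S T by (intro exI[of _ "S \<union> T"]) blast
  qed
  show "A \<subseteq> N"
  proof
    fix x assume x: "x \<in> A"
    then have "x \<in> v_closure R {a, x}"
      using subset_v_closure[of "{a, x}"] a A(1) by blast
    then show "x \<in> N"
      unfolding N using a x by (intro exI[of _ "{a, x}"]) simp
  qed
  have v_ideal: "ideal (v_closure R S) (ring_on R)" if "S \<subseteq> A" for S
    using v_closure_ideal that A(1) by blast
  have "ideal N (ring_on R)"
    unfolding ideal_iff
  proof (intro conjI ballI)
    show "N \<subseteq> R"
      using N idealD(1)[OF v_ideal] by blast
    show "0 \<in> N"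
      unfolding N using a idealD(2)[OF v_ideal[of "{a}"]] by (intro exI[of _ "{a}"]) simp
    show "x + y \<in> N" if xy: "x \<in> N" "y \<in> N" for x y
    proof -
      obtain S where S: "finite S" "S \<subseteq> A" "\<not> S \<subseteq> {0}" "{x, y} \<subseteq> v_closure R S"
        using directed[of "{x, y}"] xy by auto
      then show ?thesis
        unfolding N using idealD(3)[OF v_ideal[OF S(2)]] by (intro exI[of _ S]) auto
    qed
    show "r * x \<in> N" if "r \<in> R" "x \<in> N" for r x
      using that idealD(4)[OF v_ideal] unfolding N by blast
  qed
  moreover have "N \<noteq> {0}"
    using a \<open>A \<subseteq> N\<close> by blast
  moreover have "v_closure R F \<subseteq> N" if F: "finite F" "F \<subseteq> N" for F
  proof -
    obtain S where S: "finite S" "S \<subseteq> A" "\<not> S \<subseteq> {0}" "F \<subseteq> v_closure R S"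
      using directed[OF F] by blast
    have "v_closure R S \<subseteq> N"
      using S(1-3) N by auto
    then show ?thesis
      using v_closure_subset_v_closure[OF S(4)] by blast
  qed
  ultimately show "t_ideal R N"
    by (simp add: t_ideal_iff)
qed

lemma t_ideal_Union_chain:
  assumes C: "C \<noteq> {}" "\<And>I. I \<in> C \<Longrightarrow> t_ideal R I" "\<And>I J. I \<in> C \<Longrightarrow> J \<in> C \<Longrightarrow> I \<subseteq> J \<or> J \<subseteq> I"
  shows "t_ideal R (\<Union>C)"
proof -
  have id: "ideal I (ring_on R)" if "I \<in> C" for I
    using C(2) that unfolding t_ideal_def by blast
  have "subset.chain UNIV C"
    using C(3) by (simp add: subset_chain_def)
  have fin: "\<exists>I\<in>C. S \<subseteq> I" if "finite S" "S \<subseteq> \<Union>C" for S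
    using finite_subset_Union_chain[OF that C(1) \<open>subset.chain UNIV C\<close>] by blast
  have "ideal (\<Union>C) (ring_on R)"
    unfolding ideal_iff
  proof (intro conjI ballI)
    show "\<Union>C \<subseteq> R"
      using idealD(1)[OF id] by blast
    show "0 \<in> \<Union>C"
      using C(1) idealD(2)[OF id] by blast
    show "x + y \<in> \<Union>C" if xy: "x \<in> \<Union>C" "y \<in> \<Union>C" for x y
    proof -
      obtain I where "I \<in> C" "{x, y} \<subseteq> I"
        using fin[of "{x, y}"] xy by auto
      then show ?thesis
        using idealD(3)[OF id] by blast
    qed
    show "r * x \<in> \<Union>C" if "r \<in> R" "x \<in> \<Union>C" for r x
      using that idealD(4)[OF id] by blast
  qed
  moreover have "\<Union>C \<noteq> {0}"
  proof -
    obtain I where I: "I \<in> C"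
      using C(1) by blast
    then obtain a where "a \<in> I" "a \<noteq> 0"
      using C(2)[OF I] idealD(2)[OF id[OF I]] unfolding t_ideal_def by blast
    then show ?thesis
      using I by blast
  qed
  moreover have "v_closure R S \<subseteq> \<Union>C" if S: "finite S" "S \<subseteq> \<Union>C" "\<not> S \<subseteq> {0}" for S
  proof -
    obtain I where "I \<in> C" "S \<subseteq> I"
      using fin S by blast
    then show ?thesis
      using t_ideal_v_closure_subset[OF C(2)] S by blast
  qed
  ultimately show ?thesis
    by (simp add: t_ideal_iff)
qed

lemma t_maximal_ideal_exists:
  assumes A: "A \<subseteq> R" "\<not> A \<subseteq> {0}"
    and proper: "\<And>S. finite S \<Longrightarrow> S \<subseteq> A \<Longrightarrow> \<not> S \<subseteq> {0} \<Longrightarrow> 1 \<notin> v_closure R S"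
  obtains P where "t_maximal_ideal R P" "A \<subseteq> P"
proof -
  let ?\<A> = "{I. t_ideal R I \<and> 1 \<notin> I \<and> A \<subseteq> I}"
  have ne_iff: "I \<noteq> R \<longleftrightarrow> 1 \<notin> I" if "t_ideal R I" for I
    using that ideal_eq_iff_one_mem unfolding t_ideal_def by blast
  have "\<Union>{v_closure R S | S. finite S \<and> S \<subseteq> A \<and> \<not> S \<subseteq> {0}} \<in> ?\<A>"
    using t_ideal_generated[OF A] proper by blast
  then have "?\<A> \<noteq> {}"
    by blast
  moreover have "\<Union>C \<in> ?\<A>" if C: "C \<noteq> {}" "subset.chain ?\<A> C" for C
    using C t_ideal_Union_chain[of C] unfolding subset_chain_def by auto
  ultimately obtain P where P: "P \<in> ?\<A>" "\<forall>I\<in>?\<A>. P \<subseteq> I \<longrightarrow> I = P"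
    using subset_Zorn_nonempty[of ?\<A>] by blast
  then have "t_maximal_ideal R P"
    unfolding t_maximal_ideal_def using ne_iff by blast
  then show thesis
    using that P by blast
qed

end

section \<open>Constants and values of integer-valued rational functions\<close>

text \<open>The embedding of \<open>K\<close> into \<open>K(X)\<close>.\<close>

definition const :: "'k::field \<Rightarrow> 'k poly fract" where
  "const c = Fract [:c:] 1"

lemma const_simps:
  "const 0 = 0" "const 1 = 1"
  "const (a + b) = const a + const b" "const (a * b) = const a * const b"
  by (simp_all add: const_def fract_collapse pCons_one) (simp add: mult.commute)

lemma const_eq_0_iff [simp]: "const c = 0 \<longleftrightarrow> c = 0"
  using eq_fract(1)[of 1 1 "[:c:]" 0] by (simp add: const_def fract_collapse)

lemma const_divide: "b \<noteq> 0 \<Longrightarrow> const (a / b) = const a / const b"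
  by (simp add: const_def eq_fract)

lemma IntR_iff:
  "f \<in> IntR E D \<longleftrightarrow>
     (\<forall>e\<in>E. \<exists>p q. f = Fract p q \<and> poly q e \<noteq> 0 \<and> poly p e / poly q e \<in> D)"
  using ratfun_eval_Fract unfolding IntR_def defined_at_def by fastforce

lemma ratfun_eval_const [simp]: "ratfun_eval (const c) e = c"
  by (simp add: const_def ratfun_eval_Fract)

lemma ratfun_eval_arith:
  assumes "defined_at f e" "defined_at g e"
  shows "ratfun_eval (f + g) e = ratfun_eval f e + ratfun_eval g e"
    and "ratfun_eval (f * g) e = ratfun_eval f e * ratfun_eval g e"
proof -
  obtain p q r s where *: "f = Fract p q" "poly q e \<noteq> 0" "g = Fract r s" "poly s e \<noteq> 0"
    using assms unfolding defined_at_def by blast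
  then have nz: "q \<noteq> 0" "s \<noteq> 0"
    by auto
  have "f + g = Fract (p * s + r * q) (q * s)" "f * g = Fract (p * r) (q * s)"
    using * nz by simp_all
  then show "ratfun_eval (f + g) e = ratfun_eval f e + ratfun_eval g e"
    and "ratfun_eval (f * g) e = ratfun_eval f e * ratfun_eval g e"
    using * by (simp_all add: ratfun_eval_Fract add_frac_eq)
qed

lemma const_mem_IntR_iff:
  assumes "E \<noteq> {}"
  shows "const c \<in> IntR E D \<longleftrightarrow> c \<in> D"
proof -
  have "defined_at (const c) e" for e
    unfolding defined_at_def const_def by (intro exI[of _ "[:c:]"] exI[of _ 1]) simp
  then show ?thesis
    using assms by (auto simp: IntR_def)
qed

lemma value_of_quotient_by_const:
  assumes "h * const c \<in> IntR E D" "c \<noteq> 0" "e \<in> E"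
  shows "\<exists>p q. h = Fract p q \<and> poly q e \<noteq> 0 \<and> (poly p e / poly q e) * c \<in> D"
proof -
  obtain p q where pq: "h * const c = Fract p q" "poly q e \<noteq> 0" "poly p e / poly q e \<in> D"
    using assms(1,3) unfolding IntR_iff by blast
  have "q \<noteq> 0"
    using pq(2) by auto
  have "h = (h * const c) * const (1 / c)"
    using assms(2) by (simp add: mult.assoc flip: const_simps(4)) (simp add: const_simps)
  also have "\<dots> = Fract (smult (1 / c) p) q"
    using pq(1) by (simp add: const_def mult.commute)
  finally have "h = Fract (smult (1 / c) p) q" .
  moreover have "poly (smult (1 / c) p) e / poly q e * c = poly p e / poly q e"
    using assms(2) by simp
  ultimately show ?thesis
    using pq by metis
qed

section \<open>Lying over for maximal and \<open>t\<close>-maximal ideals\<close>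

lemma maximal_ideal_lies_over:
  fixes D E :: "'k::field set"
  assumes D: "subdomain D (ring_of_type_algebra :: 'k ring)"
    and E: "E \<noteq> {}"
    and M: "maximalideal M (ring_on D)"
  obtains P where "maximalideal P (ring_on (IntR E D))" "{c. const c \<in> P} = M"
proof -
  interpret D: field_subring D
    by (rule field_subring_of_subdomain[OF D])
  interpret R: field_subring "IntR E D"
    by (rule field_subring_of_subdomain[OF IntR_subdomain[OF D]])
  interpret M: maximalideal M "ring_on D"
    by (rule M)
  note Mid = D.idealD[OF M.is_ideal]
  have const_mem: "const c \<in> IntR E D" if "c \<in> D" for c
    using that const_mem_IntR_iff[OF E] by blast
  obtain e where e: "e \<in> E"
    using E by blast
  have ev_mem: "ratfun_eval f e \<in> D" if "f \<in> IntR E D" for f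
    using that e by (simp add: IntR_def)
  have ev: "ratfun_eval (f + g) e = ratfun_eval f e + ratfun_eval g e"
    "ratfun_eval (f * g) e = ratfun_eval f e * ratfun_eval g e"
    if "f \<in> IntR E D" "g \<in> IntR E D" for f g
    using that e by (simp_all add: IntR_def ratfun_eval_arith)
  define P where "P = {f \<in> IntR E D. ratfun_eval f e \<in> M}"
  have trace: "{c. const c \<in> P} = M"
    using Mid(1) const_mem_IntR_iff[OF E] by (auto simp: P_def)
  have "0 \<in> P"
    using trace Mid(2) const_simps(1) by (metis mem_Collect_eq)
  have P: "ideal P (ring_on (IntR E D))"
    unfolding R.ideal_iff
    using \<open>0 \<in> P\<close> ev ev_mem Mid(3,4) R.add_mem R.mult_mem by (auto simp: P_def)
  have "maximalideal P (ring_on (IntR E D))"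
  proof (rule maximalidealI[OF P])
    have "1 \<notin> M"
      using M.I_notcarr D.ideal_eq_iff_one_mem[OF M.is_ideal] by auto
    then show "carrier (ring_on (IntR E D)) \<noteq> P"
      using trace const_simps(2) R.one_mem by (metis mem_Collect_eq ring_on_simps(1))
  next
    fix J assume J: "ideal J (ring_on (IntR E D))" "P \<subseteq> J"
    note Jid = R.idealD[OF J(1)]
    \<comment> \<open>\<open>J\<close> is determined by its constants, since \<open>f - f(e)\<close> lies in \<open>P\<close>.\<close>
    have J_iff: "f \<in> J \<longleftrightarrow> const (ratfun_eval f e) \<in> J" if f: "f \<in> IntR E D" for f
    proof -
      let ?c = "ratfun_eval f e"
      have c: "const (- ?c) \<in> IntR E D"
        using f ev_mem D.uminus_mem const_mem by blast
      have "f + const (- ?c) \<in> P"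
        using c f Mid(2) R.add_mem by (simp add: P_def ev)
      then have g: "f + const (- ?c) \<in> J"
        using J(2) by blast
      have cc: "const (- ?c) = - const ?c"
        using const_simps(3)[of "?c" "- ?c"] by (simp add: const_simps(1) eq_neg_iff_add_eq_0 add.commute)
      have g': "- (f + const (- ?c)) \<in> J"
        using Jid(4)[OF R.uminus_mem[OF R.one_mem] g] by simp
      show ?thesis
        using Jid(3)[OF g, of "const ?c"] Jid(3)[OF g', of f] by (auto simp: cc)
    qed
    define J' where "J' = {c \<in> D. const c \<in> J}"
    have "ideal J' (ring_on D)"
      unfolding D.ideal_iff J'_def
      using Jid const_mem D.zero_mem D.add_mem D.mult_mem by (auto simp: const_simps)
    moreover have "M \<subseteq> J'"
      using trace J(2) Mid(1) by (auto simp: J'_def)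
    ultimately have "J' = M \<or> J' = D"
      using M.I_maximal[of J'] by (auto simp: J'_def)
    then show "J = P \<or> J = carrier (ring_on (IntR E D))"
    proof
      assume "J' = M"
      then have "J = P"
        using J_iff Jid(1) ev_mem J(2) by (auto simp: J'_def P_def)
      then show ?thesis ..
    next
      assume "J' = D"
      then have "J = IntR E D"
        using J_iff Jid(1) ev_mem by (auto simp: J'_def)
      then show ?thesis
        by simp
    qed
  qed
  then show thesis
    using that trace by blast
qed

text \<open>
  The identity \<open>(S R)\<^sub>v \<inter> D = S\<^sub>v\<close>. The inclusion of the right-hand side rests on
  \<open>value_of_quotient_by_const\<close>, which applies as \<open>S\<close> has a nonzero element; the other one only on
  the fact that the inverse of \<open>S\<close> in \<open>D\<close> consists of elements of \<open>K\<close> which, as constants, lie in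
  the inverse of \<open>S\<close> in \<open>R\<close>.
\<close>

lemma const_mem_v_closure_iff:
  fixes D E :: "'k::field set"
  assumes D: "subdomain D (ring_of_type_algebra :: 'k ring)"
    and K: "quot_field D = UNIV"
    and E: "E \<noteq> {}"
    and S: "\<not> S \<subseteq> {0}"
  shows "const a \<in> v_closure (IntR E D) (const ` S) \<longleftrightarrow> a \<in> v_closure D S"
proof -
  have quot: "const x \<in> quot_field (IntR E D)" for x
  proof -
    obtain c d where "x = c / d" "c \<in> D" "d \<in> D" "d \<noteq> 0"
      using K unfolding quot_field_def by blast
    moreover from this have "const x = const c / const d"
      by (simp add: const_divide)
    ultimately show ?thesis
      unfolding quot_field_def using const_mem_IntR_iff[OF E]
      by (intro CollectI exI[of _ "const c"] exI[of _ "const d"]) simp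
  qed
  show ?thesis
  proof
    assume a: "const a \<in> v_closure (IntR E D) (const ` S)"
    show "a \<in> v_closure D S"
      unfolding v_closure_def frac_inverse_def[of D "frac_inverse D S"]
    proof (intro CollectI conjI ballI)
      show "a \<in> quot_field D"
        by (simp add: K)
      fix y assume "y \<in> frac_inverse D S"
      then have "\<forall>s\<in>S. const (y * s) \<in> IntR E D"
        using const_mem_IntR_iff[OF E] unfolding frac_inverse_def by blast
      then have "const y \<in> frac_inverse (IntR E D) (const ` S)"
        using quot unfolding frac_inverse_def by (auto simp: const_simps)
      then have "const (a * y) \<in> IntR E D"
        using a unfolding v_closure_def
          frac_inverse_def[of "IntR E D" "frac_inverse (IntR E D) (const ` S)"]
        by (auto simp: const_simps)
      then show "a * y \<in> D"
        using const_mem_IntR_iff[OF E] by blast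
    qed
  next
    assume a: "a \<in> v_closure D S"
    obtain s0 where s0: "s0 \<in> S" "s0 \<noteq> 0"
      using S by blast
    interpret D: field_subring D
      by (rule field_subring_of_subdomain[OF D])
    show "const a \<in> v_closure (IntR E D) (const ` S)"
      unfolding v_closure_def
        frac_inverse_def[of "IntR E D" "frac_inverse (IntR E D) (const ` S)"]
    proof (intro CollectI conjI ballI)
      show "const a \<in> quot_field (IntR E D)"
        by (rule quot)
      fix h assume "h \<in> frac_inverse (IntR E D) (const ` S)"
      then have h: "h * const s \<in> IntR E D" if "s \<in> S" for s
        using that unfolding frac_inverse_def by blast
      show "const a * h \<in> IntR E D"
        unfolding IntR_iff
      proof
        fix e assume e: "e \<in> E"
        obtain p q where pq: "h = Fract p q" "poly q e \<noteq> 0"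
          using value_of_quotient_by_const[OF h[OF s0(1)] s0(2) e] by blast
        let ?y = "poly p e / poly q e"
        have "?y * s \<in> D" if s: "s \<in> S" for s
        proof (cases "s = 0")
          case True
          then show ?thesis
            by (simp add: D.zero_mem)
        next
          case False
          then obtain p' q' where *: "h = Fract p' q'" "poly q' e \<noteq> 0"
            "(poly p' e / poly q' e) * s \<in> D"
            using value_of_quotient_by_const[OF h[OF s] _ e] by blast
          have "?y = poly p' e / poly q' e"
            using ratfun_eval_Fract[OF pq(2), of p] ratfun_eval_Fract[OF *(2), of p'] pq(1) *(1)
            by simp
          then show ?thesis
            using *(3) by simp
        qed
        then have "?y \<in> frac_inverse D S"
          unfolding frac_inverse_def by (simp add: K)
        then have "a * ?y \<in> D"
          using a unfolding v_closure_def frac_inverse_def[of D "frac_inverse D S"] by blast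
        moreover have "const a * h = Fract (smult a p) q"
          by (simp add: pq(1) const_def)
        ultimately show "\<exists>p q. const a * h = Fract p q \<and> poly q e \<noteq> 0 \<and> poly p e / poly q e \<in> D"
          using pq(2) by (intro exI[of _ "smult a p"] exI[of _ q]) simp
      qed
    qed
  qed
qed

lemma t_maximal_ideal_lies_over:
  fixes D E :: "'k::field set"
  assumes D: "subdomain D (ring_of_type_algebra :: 'k ring)"
    and K: "quot_field D = UNIV"
    and E: "E \<noteq> {}"
    and M: "t_maximal_ideal D M"
  obtains P where "t_maximal_ideal (IntR E D) P" "{c. const c \<in> P} = M"
proof -
  interpret D: field_subring D
    by (rule field_subring_of_subdomain[OF D])
  interpret R: field_subring "IntR E D"
    by (rule field_subring_of_subdomain[OF IntR_subdomain[OF D]])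
  note v_iff = const_mem_v_closure_iff[OF D K E]
  have Mt: "t_ideal D M" "M \<noteq> D" and Mmax: "\<And>I. t_ideal D I \<Longrightarrow> I \<noteq> D \<Longrightarrow> M \<subseteq> I \<Longrightarrow> I = M"
    using M unfolding t_maximal_ideal_def by blast+
  have Mi: "ideal M (ring_on D)" "M \<noteq> {0}"
    using Mt(1) unfolding t_ideal_def by blast+
  note Mid = D.idealD[OF Mi(1)]
  have "1 \<notin> M"
    using D.ideal_eq_iff_one_mem[OF Mi(1)] Mt(2) by blast
  have nz: "\<not> const ` S \<subseteq> {0} \<longleftrightarrow> \<not> S \<subseteq> {0}" for S :: "'k set"
    by (auto simp: subset_iff)
  have "const ` M \<subseteq> IntR E D"
    using Mid(1) const_mem_IntR_iff[OF E] by blast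
  moreover have "\<not> const ` M \<subseteq> {0}"
    unfolding nz using Mi(2) Mid(2) by blast
  moreover have "1 \<notin> v_closure (IntR E D) T"
    if T: "finite T" "T \<subseteq> const ` M" "\<not> T \<subseteq> {0}" for T
  proof -
    obtain S where S: "finite S" "S \<subseteq> M" "T = const ` S"
      using T finite_subset_image by metis
    then have "v_closure D S \<subseteq> M"
      using D.t_ideal_v_closure_subset[OF Mt(1)] T(3) nz by simp
    moreover have "\<not> S \<subseteq> {0}"
      using S(3) T(3) nz by simp
    ultimately show ?thesis
      using v_iff[of S 1] \<open>1 \<notin> M\<close> S(3) by (auto simp: const_simps(2))
  qed
  ultimately obtain P where P: "t_maximal_ideal (IntR E D) P" "const ` M \<subseteq> P"
    using R.t_maximal_ideal_exists by blast
  have Pt: "t_ideal (IntR E D) P" "P \<noteq> IntR E D"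
    using P(1) unfolding t_maximal_ideal_def by blast+
  have Pi: "ideal P (ring_on (IntR E D))"
    using Pt(1) unfolding t_ideal_def by blast
  note Pid = R.idealD[OF Pi]
  define Q where "Q = {c. const c \<in> P}"
  have MQ: "M \<subseteq> Q"
    using P(2) by (auto simp: Q_def)
  have "ideal Q (ring_on D)"
    unfolding D.ideal_iff
  proof (intro conjI ballI)
    show "Q \<subseteq> D"
      using Pid(1) const_mem_IntR_iff[OF E] by (auto simp: Q_def)
    show "0 \<in> Q" "\<And>x y. x \<in> Q \<Longrightarrow> y \<in> Q \<Longrightarrow> x + y \<in> Q"
      using Pid(2,3) by (simp_all add: Q_def const_simps)
    show "r * x \<in> Q" if "r \<in> D" "x \<in> Q" for r x
      using that Pid(4) const_mem_IntR_iff[OF E] by (simp add: Q_def const_simps)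
  qed
  moreover have "Q \<noteq> {0}"
    using MQ Mi(2) Mid(2) by blast
  moreover have "v_closure D S \<subseteq> Q" if S: "finite S" "S \<subseteq> Q" "\<not> S \<subseteq> {0}" for S
  proof
    fix a assume "a \<in> v_closure D S"
    then have "const a \<in> v_closure (IntR E D) (const ` S)"
      using v_iff[OF S(3)] by blast
    moreover have "finite (const ` S)" "const ` S \<subseteq> P" "\<not> const ` S \<subseteq> {0}"
      using S nz by (auto simp: Q_def)
    ultimately show "a \<in> Q"
      using R.t_ideal_v_closure_subset[OF Pt(1)] unfolding Q_def by blast
  qed
  ultimately have "t_ideal D Q"
    by (simp add: D.t_ideal_iff)
  moreover have "1 \<notin> Q"
    using R.ideal_eq_iff_one_mem[OF Pi] Pt(2) by (simp add: Q_def const_simps(2))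
  then have "Q \<noteq> D"
    using D.one_mem by blast
  ultimately have "Q = M"
    using Mmax MQ by blast
  then show thesis
    using that P(1) unfolding Q_def by blast
qed

section \<open>Descent of finite character\<close>

text \<open>The trace of \<open>P\<close> on \<open>K\<close> determines \<open>M\<close>, so there are no more \<open>M\<close> than \<open>P\<close>.\<close>

lemma finite_ideals_by_lying_over:
  assumes fin: "finite {P. \<P> P \<and> const x \<in> P}"
    and over: "\<And>M. \<M> M \<Longrightarrow> \<exists>P. \<P> P \<and> {c. const c \<in> P} = M"
  shows "finite {M. \<M> M \<and> x \<in> M}"
proof (rule finite_subset)
  show "{M. \<M> M \<and> x \<in> M} \<subseteq> (\<lambda>P. {c. const c \<in> P}) ` {P. \<P> P \<and> const x \<in> P}"
    using over by blast
qed (use fin in simp)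

theorem proposition3p7:
  fixes D E :: "'k::field set"
  assumes "subdomain D (ring_of_type_algebra :: 'k ring)"
    and "quot_field D = UNIV"
    and "E \<noteq> {}"
  shows "(finite_character (IntR E D) \<longrightarrow> finite_character D) \<and>
         (t_finite_character (IntR E D) \<longrightarrow> t_finite_character D)"
proof (intro conjI impI)
  have const: "const x \<in> IntR E D" "const x \<noteq> 0" if "x \<in> D" "x \<noteq> 0" for x
    using that const_mem_IntR_iff[OF assms(3)] by auto
  show "finite_character D" if "finite_character (IntR E D)"
    unfolding finite_character_def
  proof (intro ballI impI)
    fix x assume x: "x \<in> D" "x \<noteq> 0"
    have "finite {P. maximalideal P (ring_on (IntR E D)) \<and> const x \<in> P}"
      using that const[OF x] unfolding finite_character_def by blast
    then show "finite {M. maximalideal M (ring_on D) \<and> x \<in> M}"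
      by (rule finite_ideals_by_lying_over) (metis maximal_ideal_lies_over[OF assms(1,3)])
  qed
  show "t_finite_character D" if "t_finite_character (IntR E D)"
    unfolding t_finite_character_def
  proof (intro ballI impI)
    fix x assume x: "x \<in> D" "x \<noteq> 0"
    have "finite {P. t_maximal_ideal (IntR E D) P \<and> const x \<in> P}"
      using that const[OF x] unfolding t_finite_character_def by blast
    then show "finite {M. t_maximal_ideal D M \<and> x \<in> M}"
      by (rule finite_ideals_by_lying_over) (metis t_maximal_ideal_lies_over[OF assms])
  qed
qed

end
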